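(* Up to equivalence, the color adjacency matrices of the perfect 4-colorings of the Platonic graphs are exactly the following. Tetrahedral graph: $\begin{pmatrix}0&1&1&1\\1&0&1&1\\1&1&0&1\\1&1&1&0\end{pmatrix}$. Cube graph: $\begin{pmatrix}0&0&0&3\\0&0&3&0\\0&1&0&2\\1&0&2&0\end{pmatrix}$, $\begin{pmatrix}0&0&1&2\\0&0&2&1\\1&2&0&0\\2&1&0&0\end{pmatrix}$, $\begin{pmatrix}0&1&1&1\\1&0&1&1\\1&1&0&1\\1&1&1&0\end{pmatrix}$, $\begin{pmatrix}0&1&1&1\\1&0&1&1\\1&1&1&0\\1&1&0&1\end{pmatrix}$, $\begin{pmatrix}1&0&1&1\\0&1&1&1\\1&1&1&0\\1&1&0&1\end{pmatrix}$. Octahedral graph: $\begin{pmatrix}0&0&2&2\\0&0&2&2\\1&1&0&2\\1&1&2&0\end{pmatrix}$, $\begin{pmatrix}0&0&2&2\\0&0&2&2\\1&1&1&1\\1&1&1&1\end{pmatrix}$. Dodecahedral graph: $\begin{pmatrix}0&0&0&3\\0&0&2&1\\0&2&0&1\\1&1&1&0\end{pmatrix}$, $\begin{pmatrix}0&0&0&3\\0&1&1&1\\0&1&1&1\\1&1&1&0\end{pmatrix}$, $\begin{pmatrix}0&0&1&2\\0&0&1&2\\1&1&1&0\\1&1&0&1\end{pmatrix}$, $\begin{pmatrix}0&0&1&2\\0&2&0&1\\1&0&2&0\\2&1&0&0\end{pmatrix}$, $\begin{pmatrix}1&0&0&2\\0&1&0&2\\0&0&1&2\\1&1&1&0\end{pmatrix}$.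 Icosahedral graph: $\begin{pmatrix}0&0&0&5\\0&0&5&0\\0&1&2&2\\1&0&2&2\end{pmatrix}$, $\begin{pmatrix}0&1&1&3\\1&0&1&3\\1&1&0&3\\1&1&1&2\end{pmatrix}$, $\begin{pmatrix}0&1&2&2\\1&0&2&2\\1&1&1&2\\1&1&2&1\end{pmatrix}$, $\begin{pmatrix}0&1&2&2\\1&2&0&2\\2&0&2&1\\2&2&1&0\end{pmatrix}$. That is, for each of these graphs $G$, a $4\times 4$ matrix is the color adjacency matrix of some perfect 4-coloring of $G$ if and only if it is equivalent to one of the matrices listed for $G$.
   Context: The Platonic graphs are the edge graphs (vertices and edges) of the five Platonic solids. An $m$-coloring of a graph $G=(V,E)$ is a partition of $V$ into $m$ disjoint nonempty sets $V_1,\ldots,V_m$ (the color classes; adjacent vertices may have the same color). The coloring is perfect if for all $i,j$ the number of neighbors of color $j$ of any vertex of color $i$ is a constant $a_{ij}$; the matrix $A=(a_{ij})_{1\le i,j\le m}$ is then called the color adjacency matrix of the perfect coloring. Two $m\times m$ matrices $A,B$ are equivalent (differ by a permutation of colors) if $B=PAP^{-1}$ for some permutation matrix $P$. *)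

theory Defs
  imports "HOL-Analysis.Analysis"
begin

type_synonym 'v graph = "'v set \<times> 'v set set"

definition verts :: "'v graph \<Rightarrow> 'v set" where
  "verts G = fst G"

definition edges :: "'v graph \<Rightarrow> 'v set set" where
  "edges G = snd G"

definition neighbors :: "'v graph \<Rightarrow> 'v \<Rightarrow> 'v set" where
  "neighbors G v = {w \<in> verts G. {v, w} \<in> edges G}"

text \<open>An \<open>m\<close>-coloring is given by its family of color classes, indexed by a finite type
  with \<open>m\<close> elements; adjacent vertices may have the same color.\<close>

definition coloring :: "'v graph \<Rightarrow> ('m::finite \<Rightarrow> 'v set) \<Rightarrow> bool" where
  "coloring G C \<longleftrightarrow>
     (\<Union>i. C i) = verts G \<and> disjoint_family C \<and> (\<forall>i. C i \<noteq> {})"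

definition perfect_coloring :: "'v graph \<Rightarrow> ('m::finite \<Rightarrow> 'v set) \<Rightarrow> bool" where
  "perfect_coloring G C \<longleftrightarrow>
     coloring G C \<and> (\<forall>i j. \<exists>a. \<forall>v\<in>C i. card (neighbors G v \<inter> C j) = a)"

text \<open>The description below is unique when \<open>C\<close> is a perfect coloring, since the color
  classes are then nonempty.\<close>

definition color_adjacency_matrix ::
    "'v graph \<Rightarrow> ('m::finite \<Rightarrow> 'v set) \<Rightarrow> real^'m^'m" where
  "color_adjacency_matrix G C =
     (\<chi> i j. real (THE a. \<forall>v\<in>C i. card (neighbors G v \<inter> C j) = a))"

definition perfect_coloring_matrices :: "'v graph \<Rightarrow> (real^'m::finite^'m) set" where
  "perfect_coloring_matrices G =
     {color_adjacency_matrix G C | C :: 'm \<Rightarrow> 'v set. perfect_coloring G C}"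

definition permutation_matrix :: "real^'m^'m \<Rightarrow> bool" where
  "permutation_matrix P \<longleftrightarrow>
     (\<exists>p. p permutes UNIV \<and> P = (\<chi> i j. if i = p j then 1 else 0))"

definition equivalent_matrices :: "real^'m^'m \<Rightarrow> real^'m^'m \<Rightarrow> bool" where
  "equivalent_matrices A B \<longleftrightarrow>
     (\<exists>P. permutation_matrix P \<and> B = P ** A ** matrix_inv P)"

definition edge_graph :: "'a::euclidean_space set \<Rightarrow> 'a graph" where
  "edge_graph S =
     ({v. v extreme_point_of S}, {{u, v} | u v. closed_segment u v edge_of S})"

definition golden_ratio :: real where
  "golden_ratio = (1 + sqrt 5) / 2"

definition tetrahedron :: "(real^3) set" where
  "tetrahedron = convex hull
     {vector [1, 1, 1], vector [1, -1, -1], vector [-1, 1, -1], vector [-1, -1, 1]}"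

definition cube :: "(real^3) set" where
  "cube = convex hull {vector [a, b, c] | a b c. a \<in> {-1, 1} \<and> b \<in> {-1, 1} \<and> c \<in> {-1, 1}}"

definition octahedron :: "(real^3) set" where
  "octahedron = convex hull
     (\<Union>a\<in>{-1, 1}. {vector [a, 0, 0], vector [0, a, 0], vector [0, 0, a]})"

definition dodecahedron :: "(real^3) set" where
  "dodecahedron = convex hull
     ({vector [a, b, c] | a b c. a \<in> {-1, 1} \<and> b \<in> {-1, 1} \<and> c \<in> {-1, 1}} \<union>
      (\<Union>a\<in>{-1, 1}. \<Union>b\<in>{-1, 1}.
         {vector [0, a / golden_ratio, b * golden_ratio],
          vector [a / golden_ratio, b * golden_ratio, 0],
          vector [b * golden_ratio, 0, a / golden_ratio]}))"

definition icosahedron :: "(real^3) set" where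
  "icosahedron = convex hull
     (\<Union>a\<in>{-1, 1}. \<Union>b\<in>{-1, 1}.
         {vector [0, a, b * golden_ratio],
          vector [a, b * golden_ratio, 0],
          vector [b * golden_ratio, 0, a]})"

end

theory Submission
  imports Defs
begin

text \<open>
  Two things make the theorem true, and both are finite.

  First, each solid is the convex hull of an explicit set \<open>V\<close> of points on a sphere, and its edges are the
  pairs of points of \<open>V\<close> at the smallest distance, that is, with the largest inner product \<open>\<kappa>\<close>.  If
  \<open>x \<bullet> y = \<kappa>\<close>, the functional \<open>x + y\<close> is maximal on \<open>V\<close> exactly at \<open>x\<close> and \<open>y\<close>, so the segment \<open>xy\<close>
  is a face.  Otherwise there are a neighbor \<open>z\<close> of \<open>x\<close> and a further vertex \<open>w\<close> such that the segments
  \<open>xy\<close> and \<open>zw\<close> cross, at their midpoints or in the golden section; a face containing \<open>xy\<close> then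
  contains the extreme point \<open>z\<close>, so it is not \<open>xy\<close>.  In coordinates from the ring generated by the
  golden ratio this is integer arithmetic, and lemma \<open>indexed_graph_golden_vec\<close> replaces the
  geometric graphs by adjacency lists of indices.

  Second, the perfect 4-colorings of a graph with at most 20 vertices can be found by a search that
  colors one vertex after the other.  The numbers of neighbors of each color seen so far are
  lower bounds for the rows of the color adjacency matrix; every row of that matrix sums to the
  degree, so a partial coloring is discarded as soon as the lower bounds in some row sum to more.
  Because color names do not matter up to equivalence, it suffices to consider colorings in which
  new colors appear in increasing order.  Lemma \<open>search_complete\<close> says that no perfect coloring escapes;
  the search leaves only matrices that are equivalent to listed ones.  Conversely, for each listed
  matrix one coloring is given.  Lemma \<open>perfect_coloring_matrices_iff_listed\<close> combines the two
  directions, with the computations as premises.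
\<close>

section \<open>Edges of polytopes inscribed in a sphere\<close>

text \<open>A supporting hyperplane cuts the hull in the hull of the generators that lie on it, so faces of
  the solids can be read off from values of a linear functional on finitely many points.\<close>

lemma supporting_face_convex_hull:
  fixes V :: "'a::euclidean_space set"
  assumes "finite V" and "\<And>v. v \<in> V \<Longrightarrow> a \<bullet> v \<le> b"
  shows "convex hull (V \<inter> {v. a \<bullet> v = b}) face_of convex hull V"
proof -
  define F where "F = convex hull V \<inter> {v. a \<bullet> v = b}"
  have "convex hull V \<subseteq> {v. a \<bullet> v \<le> b}"
    using assms(2) by (intro hull_minimal) (auto simp: convex_halfspace_le)
  then have F: "F face_of convex hull V"
    unfolding F_def by (intro face_of_Int_supporting_hyperplane_le) auto
  then obtain T where T: "T \<subseteq> V" "F = convex hull T"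
    using face_of_convex_hull_subset assms(1) finite_imp_compact by metis
  have "T \<subseteq> V \<inter> {v. a \<bullet> v = b}"
    using T hull_subset[of T convex] by (auto simp: F_def)
  then have "F \<subseteq> convex hull (V \<inter> {v. a \<bullet> v = b})"
    using T(2) hull_mono by metis
  moreover have "convex hull (V \<inter> {v. a \<bullet> v = b}) \<subseteq> F"
    unfolding F_def
    by (intro hull_minimal convex_Int convex_convex_hull convex_hyperplane) (auto intro: hull_inc)
  ultimately show ?thesis
    using F by auto
qed

text \<open>The adjacency in a Platonic graph is described by inner products: two vertices are joined exactly
  when their inner product has the largest value \<open>\<kappa>\<close> that occurs between distinct vertices.  That such
  pairs are edges follows from the sphere alone.  The converse needs the last assumption: the
  segment of a non-adjacent pair is crossed by a segment towards a third vertex.\<close>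

locale spherical_polytope =
  fixes V :: "'a::euclidean_space set" and \<rho> \<kappa> :: real
  assumes finite_V: "finite V"
    and on_sphere: "v \<in> V \<Longrightarrow> v \<bullet> v = \<rho>"
    and separated: "v \<in> V \<Longrightarrow> w \<in> V \<Longrightarrow> v \<noteq> w \<Longrightarrow> v \<bullet> w \<le> \<kappa>"
    and less: "\<kappa> < \<rho>"
    and crossing: "x \<in> V \<Longrightarrow> y \<in> V \<Longrightarrow> x \<noteq> y \<Longrightarrow> x \<bullet> y \<noteq> \<kappa> \<Longrightarrow>
      \<exists>z\<in>V - {x, y}. \<exists>w\<in>V. \<exists>\<alpha>>0. \<exists>\<beta>>0. \<exists>\<gamma>>0. \<exists>\<delta>>0.
        \<alpha> + \<beta> = \<gamma> + \<delta> \<and> \<alpha> *\<^sub>R x + \<beta> *\<^sub>R y = \<gamma> *\<^sub>R z + \<delta> *\<^sub>R w"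
begin

text \<open>The functional \<open>v \<bullet> _\<close> attains its maximum on \<open>V\<close> at \<open>v\<close> only.\<close>

lemma extreme_point_iff: "v extreme_point_of convex hull V \<longleftrightarrow> v \<in> V"
proof
  assume v: "v \<in> V"
  have "V \<inter> {w. v \<bullet> w = \<rho>} = {v}"
    using v on_sphere separated less by fastforce
  moreover have "v \<bullet> w \<le> \<rho>" if "w \<in> V" for w
    using v that on_sphere separated less by fastforce
  ultimately have "convex hull {v} face_of convex hull V"
    using supporting_face_convex_hull[OF finite_V, of v \<rho>] by metis
  then show "v extreme_point_of convex hull V"
    by (simp add: face_of_singleton)
qed (rule extreme_point_of_convex_hull)

text \<open>The supporting functional is \<open>x + y\<close>: it takes the value \<open>\<rho> + \<kappa>\<close> at \<open>x\<close> and \<open>y\<close>, and at most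
  \<open>2 * \<kappa> < \<rho> + \<kappa>\<close> at every other point of \<open>V\<close>.\<close>

lemma edge_if_adjacent:
  assumes "x \<in> V" "y \<in> V" "x \<bullet> y = \<kappa>"
  shows "closed_segment x y edge_of convex hull V"
proof -
  have ne: "x \<noteq> y"
    using assms on_sphere less by auto
  have sum_less: "(x + y) \<bullet> v < \<rho> + \<kappa>" if "v \<in> V" "v \<noteq> x" "v \<noteq> y" for v
    using separated[of x v] separated[of y v] that assms less by (simp add: inner_add_left)
  moreover have sum_eq: "(x + y) \<bullet> x = \<rho> + \<kappa>" "(x + y) \<bullet> y = \<rho> + \<kappa>"
    using assms on_sphere by (simp_all add: inner_add_left inner_commute[of y x])
  ultimately have "V \<inter> {v. (x + y) \<bullet> v = \<rho> + \<kappa>} = {x, y}"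
    using assms by force
  moreover have "(x + y) \<bullet> v \<le> \<rho> + \<kappa>" if "v \<in> V" for v
    using sum_less[of v] sum_eq that by fastforce
  ultimately have "convex hull {x, y} face_of convex hull V"
    using supporting_face_convex_hull[OF finite_V, of "x + y" "\<rho> + \<kappa>"] by metis
  then show ?thesis
    using ne by (simp add: edge_of_def segment_convex_hull aff_dim_convex_hull)
qed

text \<open>A face that contains an inner point of a segment contains its ends.  So if \<open>x\<close> and \<open>y\<close> were not
  adjacent, the crossing would put a third vertex \<open>z\<close> into the face \<open>closed_segment x y\<close>; but \<open>z\<close> is
  extreme, hence not inside a segment.\<close>

lemma adjacent_if_edge:
  assumes "x \<in> V" "y \<in> V" "closed_segment x y edge_of convex hull V"
  shows "x \<bullet> y = \<kappa>"
proof (rule ccontr)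
  assume not_adj: "x \<bullet> y \<noteq> \<kappa>"
  have face: "closed_segment x y face_of convex hull V" and ne: "x \<noteq> y"
    using assms(3) by (auto simp: edge_of_def)
  obtain z w \<alpha> \<beta> \<gamma> \<delta> where zw: "z \<in> V" "z \<noteq> x" "z \<noteq> y" "w \<in> V"
    and pos: "0 < \<alpha>" "0 < \<beta>" "0 < \<gamma>" "0 < \<delta>" "\<alpha> + \<beta> = \<gamma> + \<delta>"
    and eq: "\<alpha> *\<^sub>R x + \<beta> *\<^sub>R y = \<gamma> *\<^sub>R z + \<delta> *\<^sub>R w"
    using crossing[OF assms(1,2) ne not_adj] by (metis Diff_iff insertI1 insertI2)
  have point_in: "(1 / (s + t)) *\<^sub>R (s *\<^sub>R a + t *\<^sub>R b) \<in> closed_segment a b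
      \<and> (a \<noteq> b \<longrightarrow> (1 / (s + t)) *\<^sub>R (s *\<^sub>R a + t *\<^sub>R b) \<in> open_segment a b)"
    if "0 < s" "0 < t" for s t :: real and a b :: 'a
  proof -
    have "(1 / (s + t)) *\<^sub>R (s *\<^sub>R a + t *\<^sub>R b) = (1 - t / (s + t)) *\<^sub>R a + (t / (s + t)) *\<^sub>R b"
      using that by (simp add: scaleR_add_right divide_simps)
    moreover have "0 < t / (s + t)" "t / (s + t) < 1"
      using that by auto
    ultimately show ?thesis
      by (metis in_segment less_imp_le)
  qed
  define p where "p = (1 / (\<alpha> + \<beta>)) *\<^sub>R (\<alpha> *\<^sub>R x + \<beta> *\<^sub>R y)"
  have p: "p = (1 / (\<gamma> + \<delta>)) *\<^sub>R (\<gamma> *\<^sub>R z + \<delta> *\<^sub>R w)"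
    by (simp add: p_def eq pos)
  have "p \<in> closed_segment x y"
    using point_in pos(1,2) by (simp add: p_def)
  moreover have "z \<in> closed_segment x y" if "z \<noteq> w"
    using face_ofD[OF face, of p z w] point_in[OF pos(3,4), of z w] that zw calculation
    by (simp add: p hull_inc)
  moreover have "p = z" if "z = w"
    using pos(3,4) that by (simp add: p flip: scaleR_add_left)
  ultimately have "z \<in> open_segment x y"
    using zw by (auto simp: open_segment_def)
  moreover have "z extreme_point_of convex hull V"
    using zw extreme_point_iff by simp
  ultimately show False
    using assms(1,2) by (auto simp: extreme_point_of_def hull_inc)
qed

lemma verts_edge_graph: "verts (edge_graph (convex hull V)) = V"
  by (simp add: verts_def edge_graph_def extreme_point_iff)

lemma neighbors_edge_graph:
  assumes "x \<in> V"
  shows "neighbors (edge_graph (convex hull V)) x = {y \<in> V. x \<bullet> y = \<kappa>}"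
proof -
  have "{x, y} \<in> edges (edge_graph (convex hull V)) \<longleftrightarrow> closed_segment x y edge_of convex hull V" for y
    by (auto simp: edges_def edge_graph_def doubleton_eq_iff closed_segment_commute)
  then show ?thesis
    using assms edge_if_adjacent adjacent_if_edge by (auto simp: neighbors_def verts_edge_graph)
qed

end

section \<open>Vertices with coordinates in the golden ring\<close>

definition indexed_graph :: "'v graph \<Rightarrow> (nat \<Rightarrow> 'v) \<Rightarrow> nat list list \<Rightarrow> bool" where
  "indexed_graph G \<phi> adj \<longleftrightarrow> bij_betw \<phi> {..<length adj} (verts G) \<and>
     (\<forall>i<length adj. distinct (adj ! i) \<and> set (adj ! i) \<subseteq> {..<length adj} \<and>
        neighbors G (\<phi> i) = \<phi> ` set (adj ! i))"

text \<open>The pair \<open>(a, b)\<close> stands for \<open>a + b * golden_ratio\<close>.  All coordinates of the solids are of this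
  form, because the inverse of the golden ratio is the golden ratio minus 1; arithmetic with them
  becomes integer arithmetic, which the simplifier carries out by rewriting.\<close>

type_synonym golden_int = "int \<times> int"
type_synonym golden_point = "golden_int \<times> golden_int \<times> golden_int"

definition golden_val :: "golden_int \<Rightarrow> real" where
  "golden_val = (\<lambda>(a, b). of_int a + of_int b * golden_ratio)"

fun golden_add :: "golden_int \<Rightarrow> golden_int \<Rightarrow> golden_int" where
  "golden_add (a, b) (c, d) = (a + c, b + d)"

fun golden_mult :: "golden_int \<Rightarrow> golden_int \<Rightarrow> golden_int" where
  "golden_mult (a, b) (c, d) = (a * c + b * d, a * d + b * c + b * d)"

fun golden_dot :: "golden_point \<Rightarrow> golden_point \<Rightarrow> golden_int" where
  "golden_dot (x, y, z) (x', y', z') =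
     golden_add (golden_mult x x') (golden_add (golden_mult y y') (golden_mult z z'))"

fun golden_comb :: "golden_int \<Rightarrow> golden_point \<Rightarrow> golden_point \<Rightarrow> golden_point" where
  "golden_comb c (x, y, z) (x', y', z') =
     (golden_add (golden_mult c x) x', golden_add (golden_mult c y) y', golden_add (golden_mult c z) z')"

definition golden_vec :: "golden_point \<Rightarrow> real^3" where
  "golden_vec = (\<lambda>(x, y, z). vector [golden_val x, golden_val y, golden_val z])"

lemma golden_ratio_pos: "0 < golden_ratio"
  by (simp add: golden_ratio_def add_pos_pos)

lemma golden_ratio_square: "golden_ratio * golden_ratio = 1 + golden_ratio"
  by (simp add: golden_ratio_def field_simps)

lemma golden_val_add: "golden_val (golden_add p q) = golden_val p + golden_val q"
  by (cases p; cases q) (simp add: golden_val_def algebra_simps)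

lemma golden_val_mult: "golden_val (golden_mult p q) = golden_val p * golden_val q"
proof -
  obtain a b c d where pq: "p = (a, b)" "q = (c, d)"
    by (cases p; cases q)
  have "golden_val p * golden_val q =
      of_int (a * c) + of_int (a * d + b * c) * golden_ratio + of_int (b * d) * (golden_ratio * golden_ratio)"
    by (simp add: pq golden_val_def algebra_simps)
  then show ?thesis
    unfolding golden_ratio_square by (simp add: pq golden_val_def algebra_simps)
qed

declare golden_add.simps [simp del] golden_mult.simps [simp del]

lemma golden_vec_dot: "golden_vec p \<bullet> golden_vec q = golden_val (golden_dot p q)"
  by (cases p rule: prod_cases3; cases q rule: prod_cases3)
    (simp add: golden_vec_def golden_val_add golden_val_mult inner_vec_def sum_3)

lemma golden_vec_comb: "golden_vec (golden_comb c p q) = golden_val c *\<^sub>R golden_vec p + golden_vec q"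
  by (cases p rule: prod_cases3; cases q rule: prod_cases3)
    (simp add: golden_vec_def golden_val_add golden_val_mult vec_eq_iff forall_3)

text \<open>For non-adjacent \<open>x\<close> and \<open>y\<close>, in each solid some neighbor \<open>z\<close> of \<open>x\<close> has a partner \<open>w\<close> such that the
  segments \<open>xy\<close> and \<open>zw\<close> are either diagonals of a parallelogram or cross in the golden section, like
  two diagonals of a regular pentagon.  The condition \<open>c * x + y = c * z + w\<close> (with \<open>c\<close> equal to 1 or to
  the golden ratio, and possibly with \<open>x\<close> and \<open>y\<close> exchanged) determines \<open>w\<close>, so only membership
  of \<open>w\<close> has to be tested.\<close>

definition crosses :: "golden_point list \<Rightarrow> golden_int \<Rightarrow> golden_point \<Rightarrow> golden_point \<Rightarrow> golden_point \<Rightarrow> bool" where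
  "crosses V c x y z \<longleftrightarrow> golden_comb c (golden_comb (-1, 0) z x) y \<in> set V"

definition crossed_via :: "golden_point list \<Rightarrow> golden_point \<Rightarrow> golden_point \<Rightarrow> golden_point \<Rightarrow> bool" where
  "crossed_via V x y z \<longleftrightarrow>
     crosses V (1, 0) x y z \<or> crosses V (0, 1) x y z \<or> crosses V (0, 1) y x z"

text \<open>\<open>K\<close> lists the inner products below \<open>k\<close>, so that the order of the reals enters only through a few
  comparisons of constants.\<close>

definition pair_check ::
    "golden_point list \<Rightarrow> golden_int \<Rightarrow> golden_int list \<Rightarrow> golden_point \<Rightarrow> golden_point \<Rightarrow> bool" where
  "pair_check V k K x y \<longleftrightarrow> x = y \<or> golden_dot x y = k \<or>
     golden_dot x y \<in> set K \<and> list_ex (crossed_via V x y) (filter (\<lambda>z. golden_dot x z = k) V)"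

definition solid_check ::
    "golden_point list \<Rightarrow> golden_int \<Rightarrow> golden_int \<Rightarrow> golden_int list \<Rightarrow> bool" where
  "solid_check V r k K \<longleftrightarrow> distinct V \<and> list_all (\<lambda>x. golden_dot x x = r) V \<and>
     list_all (case_prod (pair_check V k K)) (List.product V V)"

definition adjacency :: "golden_point list \<Rightarrow> golden_int \<Rightarrow> nat list list" where
  "adjacency V k = map (\<lambda>x. filter (\<lambda>j. golden_dot x (V ! j) = k) [0..<length V]) V"

lemma crossed_via_imp:
  assumes "crossed_via V x y z"
  obtains w c where "w \<in> set V" "0 < c"
    "c *\<^sub>R golden_vec x + 1 *\<^sub>R golden_vec y = c *\<^sub>R golden_vec z + 1 *\<^sub>R golden_vec w \<or>
     1 *\<^sub>R golden_vec x + c *\<^sub>R golden_vec y = c *\<^sub>R golden_vec z + 1 *\<^sub>R golden_vec w"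
proof -
  obtain c p q where c: "c = (1, 0) \<or> c = (0, 1)" and pq: "p = x \<and> q = y \<or> c = (0, 1) \<and> p = y \<and> q = x"
    and w: "golden_comb c (golden_comb (-1, 0) z p) q \<in> set V"
    using assms unfolding crossed_via_def crosses_def by blast
  have val: "golden_val (-1, 0) = -1" "golden_val (1, 0) = 1" "golden_val (0, 1) = golden_ratio"
    by (simp_all add: golden_val_def)
  have "golden_vec (golden_comb c (golden_comb (-1, 0) z p) q) =
      golden_val c *\<^sub>R (golden_vec p - golden_vec z) + golden_vec q"
    by (simp add: golden_vec_comb val)
  then have "golden_val c *\<^sub>R golden_vec p + 1 *\<^sub>R golden_vec q =
      golden_val c *\<^sub>R golden_vec z + 1 *\<^sub>R golden_vec (golden_comb c (golden_comb (-1, 0) z p) q)"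
    by (simp add: algebra_simps)
  moreover have "0 < golden_val c"
    using c golden_ratio_pos by (auto simp: val)
  ultimately show ?thesis
    using w pq that by (metis add.commute)
qed

text \<open>Distinct codes could a priori denote the same point.  They do not, since distinct entries of \<open>V\<close> have
  an inner product different from the square of the norm.\<close>

lemma
  assumes chk: "solid_check V r k K" and less: "golden_val k < golden_val r"
    and K: "\<And>l. l \<in> set K \<Longrightarrow> golden_val l < golden_val k"
  shows spherical_polytope_golden_vec:
      "spherical_polytope (golden_vec ` set V) (golden_val r) (golden_val k)"
    and inj_golden_vec: "inj_on golden_vec (set V)"
    and golden_dot_eq_iff: "\<And>x y. x \<in> set V \<Longrightarrow> y \<in> set V \<Longrightarrow>
      golden_vec x \<bullet> golden_vec y = golden_val k \<longleftrightarrow> golden_dot x y = k"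
proof -
  have norm: "golden_dot x x = r" if "x \<in> set V" for x
    using chk that by (simp add: solid_check_def list_all_iff)
  have pair: "x = y \<or> golden_dot x y = k \<or> golden_dot x y \<in> set K \<and> (\<exists>z\<in>set V. golden_dot x z = k \<and> crossed_via V x y z)"
    if "x \<in> set V" "y \<in> set V" for x y
    using chk that by (fastforce simp: solid_check_def list_all_iff list_ex_iff pair_check_def simp del: split_paired_All split_paired_Ex)
  have pair_le: "golden_vec x \<bullet> golden_vec y \<le> golden_val k"
    if "x \<in> set V" "y \<in> set V" "x \<noteq> y" for x y
    using pair[of x y] K[of "golden_dot x y"] that by (auto simp: golden_vec_dot)
  show "inj_on golden_vec (set V)"
  proof (rule inj_onI, rule ccontr)
    fix x y assume "x \<in> set V" "y \<in> set V" "golden_vec x = golden_vec y" "x \<noteq> y"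
    then show False
      using pair_le[of x y] norm[of y] golden_vec_dot[of y y] less by simp
  qed
  show adj: "golden_vec x \<bullet> golden_vec y = golden_val k \<longleftrightarrow> golden_dot x y = k"
    if "x \<in> set V" "y \<in> set V" for x y
    using pair[OF that] K[of "golden_dot x y"] norm[OF that(1)] less by (auto simp: golden_vec_dot)
  show "spherical_polytope (golden_vec ` set V) (golden_val r) (golden_val k)"
  proof
    fix v w assume "v \<in> golden_vec ` set V" "w \<in> golden_vec ` set V" "v \<noteq> w"
    then show "v \<bullet> w \<le> golden_val k"
      using pair_le by blast
  next
    fix v w assume v: "v \<in> golden_vec ` set V" and w: "w \<in> golden_vec ` set V"
      and ne: "v \<noteq> w" "v \<bullet> w \<noteq> golden_val k"
    obtain x y where xy: "x \<in> set V" "y \<in> set V" "v = golden_vec x" "w = golden_vec y"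
      using v w by auto
    then obtain z where z: "z \<in> set V" "golden_dot x z = k" and via: "crossed_via V x y z"
      using pair[of x y] ne by (auto simp: golden_vec_dot simp del: split_paired_All split_paired_Ex)
    from via obtain u c where u: "u \<in> set V" and c: "0 < c"
      and eq: "c *\<^sub>R v + 1 *\<^sub>R w = c *\<^sub>R golden_vec z + 1 *\<^sub>R golden_vec u \<or>
        1 *\<^sub>R v + c *\<^sub>R w = c *\<^sub>R golden_vec z + 1 *\<^sub>R golden_vec u"
      unfolding xy by (rule crossed_via_imp)
    have "v \<bullet> golden_vec z = golden_val k" "v \<bullet> v = golden_val r"
      using z(2) norm[OF xy(1)] xy(3) by (simp_all add: golden_vec_dot)
    then have "golden_vec z \<noteq> v" "golden_vec z \<noteq> w"
      using less ne(2) by auto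
    then have "golden_vec z \<in> golden_vec ` set V - {v, w}" "golden_vec u \<in> golden_vec ` set V"
      using z u by auto
    moreover have "\<exists>\<alpha>>0. \<exists>\<beta>>0. \<exists>\<gamma>>0. \<exists>\<delta>>0. \<alpha> + \<beta> = \<gamma> + \<delta> \<and>
        \<alpha> *\<^sub>R v + \<beta> *\<^sub>R w = \<gamma> *\<^sub>R golden_vec z + \<delta> *\<^sub>R golden_vec u"
      using eq
    proof
      assume "c *\<^sub>R v + 1 *\<^sub>R w = c *\<^sub>R golden_vec z + 1 *\<^sub>R golden_vec u"
      then show ?thesis
        using c zero_less_one by blast
    next
      assume "1 *\<^sub>R v + c *\<^sub>R w = c *\<^sub>R golden_vec z + 1 *\<^sub>R golden_vec u"
      then show ?thesis
        using c zero_less_one add.commute by metis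
    qed
    ultimately show "\<exists>z\<in>golden_vec ` set V - {v, w}. \<exists>w'\<in>golden_vec ` set V.
        \<exists>\<alpha>>0. \<exists>\<beta>>0. \<exists>\<gamma>>0. \<exists>\<delta>>0. \<alpha> + \<beta> = \<gamma> + \<delta> \<and> \<alpha> *\<^sub>R v + \<beta> *\<^sub>R w = \<gamma> *\<^sub>R z + \<delta> *\<^sub>R w'"
      by blast
  qed (use norm less in \<open>auto simp: golden_vec_dot\<close>)
qed

lemma indexed_graph_golden_vec:
  assumes chk: "solid_check V r k K" and less: "golden_val k < golden_val r"
    and K: "\<And>l. l \<in> set K \<Longrightarrow> golden_val l < golden_val k"
  shows "indexed_graph (edge_graph (convex hull (golden_vec ` set V)))
    (\<lambda>i. golden_vec (V ! i)) (adjacency V k)"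
proof -
  interpret spherical_polytope "golden_vec ` set V" "golden_val r" "golden_val k"
    using assms by (rule spherical_polytope_golden_vec)
  have len: "length (adjacency V k) = length V"
    by (simp add: adjacency_def)
  have "bij_betw (golden_vec \<circ> (!) V) {..<length V} (golden_vec ` set V)"
    using chk inj_golden_vec[OF assms]
    by (intro bij_betw_trans[OF bij_betw_nth inj_on_imp_bij_betw]) (auto simp: solid_check_def)
  then have bij: "bij_betw (\<lambda>i. golden_vec (V ! i)) {..<length V} (golden_vec ` set V)"
    by (simp add: o_def)
  have "neighbors (edge_graph (convex hull (golden_vec ` set V))) (golden_vec (V ! i)) =
      (\<lambda>i. golden_vec (V ! i)) ` set (adjacency V k ! i)" if i: "i < length V" for i
  proof -
    have "neighbors (edge_graph (convex hull (golden_vec ` set V))) (golden_vec (V ! i)) =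
        golden_vec ` {y \<in> set V. golden_dot (V ! i) y = k}"
      using i golden_dot_eq_iff[OF assms, of "V ! i"] by (auto simp: neighbors_edge_graph simp del: split_paired_All split_paired_Ex)
    also have "\<dots> = golden_vec ` (!) V ` {j. j < length V \<and> golden_dot (V ! i) (V ! j) = k}"
      unfolding set_conv_nth image_image by blast
    finally show ?thesis
      using i by (auto simp: adjacency_def)
  qed
  then show ?thesis
    using bij by (auto simp: indexed_graph_def len verts_edge_graph adjacency_def)
qed

section \<open>Perfect colorings of indexed graphs\<close>

definition index_coloring :: "nat list list \<Rightarrow> (nat \<Rightarrow> 'm) \<Rightarrow> ('m \<Rightarrow> 'm \<Rightarrow> nat) \<Rightarrow> bool" where
  "index_coloring adj f a \<longleftrightarrow> f ` {..<length adj} = UNIV \<and>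
     (\<forall>v<length adj. \<forall>j. count_list (map f (adj ! v)) j = a (f v) j)"

lemma count_list_map_card:
  "distinct ws \<Longrightarrow> count_list (map f ws) j = card {w \<in> set ws. f w = j}"
proof (induction ws)
  case (Cons w ws)
  have "{u \<in> set (w # ws). f u = j} = (if f w = j then insert w else id) {u \<in> set ws. f u = j}"
    by auto
  then show ?case
    using Cons by auto
qed simp

lemma color_adjacency_matrix_nth:
  assumes "C i \<noteq> {}" and "\<And>v. v \<in> C i \<Longrightarrow> card (neighbors G v \<inter> C j) = a"
  shows "color_adjacency_matrix G C $ i $ j = real a"
proof -
  have "(THE a. \<forall>v\<in>C i. card (neighbors G v \<inter> C j) = a) = a"
    using assms by (intro the_equality) auto
  then show ?thesis
    by (simp add: color_adjacency_matrix_def)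
qed

text \<open>A color adjacency matrix has natural entries, so it comes from a coloring of the indices
  together with a matrix \<open>a\<close> of naturals.\<close>

lemma perfect_coloring_matrices_iff:
  fixes A :: "real^'m::finite^'m"
  assumes G: "indexed_graph G \<phi> adj"
  shows "A \<in> perfect_coloring_matrices G \<longleftrightarrow>
    (\<exists>f a. index_coloring adj f a \<and> A = (\<chi> i j. real (a i j)))"
proof -
  define n where "n = length adj"
  have inj: "inj_on \<phi> {..<n}" and verts: "verts G = \<phi> ` {..<n}"
    using G by (auto simp: indexed_graph_def bij_betw_def n_def)
  have adj: "distinct (adj ! v)" "set (adj ! v) \<subseteq> {..<n}"
      "neighbors G (\<phi> v) = \<phi> ` set (adj ! v)" if "v < n" for v
    using G that by (auto simp: indexed_graph_def n_def)
  have card_eq: "card (neighbors G (\<phi> v) \<inter> C j) = count_list (map f (adj ! v)) j"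
    if C: "\<And>j. C j = \<phi> ` {u. u < n \<and> f u = j}" and v: "v < n"
    for C :: "'m \<Rightarrow> _" and f and v j
  proof -
    have "neighbors G (\<phi> v) \<inter> C j = \<phi> ` {w \<in> set (adj ! v). f w = j}"
      using inj adj[OF v] by (auto simp: C dest: inj_onD)
    moreover have "inj_on \<phi> {w \<in> set (adj ! v). f w = j}"
      using inj adj(2)[OF v] by (auto intro: inj_on_subset)
    ultimately show ?thesis
      using adj(1)[OF v] by (simp add: card_image count_list_map_card)
  qed
  show ?thesis
  proof
    assume "A \<in> perfect_coloring_matrices G"
    then obtain C :: "'m \<Rightarrow> _" where A: "A = color_adjacency_matrix G C" and C: "perfect_coloring G C"
      by (auto simp: perfect_coloring_matrices_def)
    have un: "(\<Union>i. C i) = \<phi> ` {..<n}" and disj: "\<And>i j. i \<noteq> j \<Longrightarrow> C i \<inter> C j = {}"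
      and ne: "\<And>i. C i \<noteq> {}"
      using C verts by (auto simp: perfect_coloring_def coloring_def disjoint_family_on_def)
    obtain a where a: "\<And>i j v. v \<in> C i \<Longrightarrow> card (neighbors G v \<inter> C j) = a i j"
      using C unfolding perfect_coloring_def by metis
    have "\<forall>v\<in>{..<n}. \<exists>i. \<phi> v \<in> C i"
      using un by blast
    then obtain f where f: "\<And>v. v < n \<Longrightarrow> \<phi> v \<in> C (f v)"
      by (metis lessThan_iff)
    have Cf: "C j = \<phi> ` {u. u < n \<and> f u = j}" for j
    proof (intro set_eqI iffI)
      fix x assume x: "x \<in> C j"
      then obtain u where "u < n" "x = \<phi> u"
        using un by blast
      then show "x \<in> \<phi> ` {u. u < n \<and> f u = j}"
        using f[of u] disj[of j "f u"] x by auto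
    qed (use f in auto)
    have "index_coloring adj f a"
      unfolding index_coloring_def
    proof (intro conjI allI impI)
      show "f ` {..<length adj} = UNIV"
      proof -
        have "i \<in> f ` {..<n}" for i
          using ne[of i] unfolding Cf[of i] by blast
        then show ?thesis
          unfolding n_def by (intro UNIV_eq_I[symmetric])
      qed
      show "count_list (map f (adj ! v)) j = a (f v) j" if "v < length adj" for v j
        using card_eq[OF Cf, of v j] a[OF f, of v j] that by (simp add: n_def)
    qed
    moreover have "A = (\<chi> i j. real (a i j))"
    proof -
      have "color_adjacency_matrix G C $ i $ j = real (a i j)" for i j
        by (rule color_adjacency_matrix_nth[where C = C and i = i, OF ne a])
      then show ?thesis
        by (simp add: A vec_eq_iff)
    qed
    ultimately show "\<exists>f a. index_coloring adj f a \<and> A = (\<chi> i j. real (a i j))"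
      by blast
  next
    assume "\<exists>f a. index_coloring adj f a \<and> A = (\<chi> i j. real (a i j))"
    then obtain f a where f: "f ` {..<n} = UNIV"
      and a: "\<And>v j. v < n \<Longrightarrow> count_list (map f (adj ! v)) j = a (f v) j"
      and A: "A = (\<chi> i j. real (a i j))"
      by (auto simp: index_coloring_def n_def)
    define C where "C j = \<phi> ` {u. u < n \<and> f u = j}" for j
    have card_C: "card (neighbors G v \<inter> C j) = a i j" if "v \<in> C i" for v i j
      using that card_eq[OF C_def] a by (auto simp: C_def)
    have ne: "C i \<noteq> {}" for i
    proof -
      have "i \<in> f ` {..<n}"
        using f by simp
      then show ?thesis
        by (auto simp: C_def)
    qed
    have "(\<Union>i. C i) = verts G"
      by (auto simp: C_def verts)
    moreover have "disjoint_family C"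
      using inj by (auto simp: disjoint_family_on_def C_def dest: inj_onD)
    ultimately have "perfect_coloring G C"
      using ne card_C by (auto simp: perfect_coloring_def coloring_def)
    moreover have "color_adjacency_matrix G C = A"
    proof -
      have "color_adjacency_matrix G C $ i $ j = real (a i j)" for i j
        by (rule color_adjacency_matrix_nth[where C = C and i = i, OF ne card_C])
      then show ?thesis
        by (simp add: A vec_eq_iff)
    qed
    ultimately show "A \<in> perfect_coloring_matrices G"
      by (auto simp: perfect_coloring_matrices_def)
  qed
qed

text \<open>The inverse of a permutation matrix is avoided by comparing \<open>B ** P\<close> with \<open>P ** A\<close> instead.\<close>

lemma equivalent_matrices_iff:
  "equivalent_matrices A B \<longleftrightarrow>
    (\<exists>p. p permutes UNIV \<and> (\<forall>i j. B $ p i $ p j = A $ i $ j))"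
proof -
  have "B = P ** A ** matrix_inv P \<longleftrightarrow> (\<forall>i j. B $ p i $ p j = A $ i $ j)"
    if p: "p permutes UNIV" and P: "P = (\<chi> i j. if i = p j then 1 else 0)" for p and P :: "real^'a^'a"
  proof -
    have "P ** transpose P = mat 1"
    proof -
      have "(P ** transpose P) $ i $ j = mat 1 $ i $ j" for i j
      proof -
        have "i = p k \<longleftrightarrow> k = inv p i" for k
          using permutes_inv_eq[OF p] by metis
        then show ?thesis
          using permutes_inverses[OF p]
          by (simp add: P matrix_matrix_mult_def transpose_def mat_def if_distrib[of "\<lambda>x. x * _"] cong: if_cong)
      qed
      then show ?thesis
        by (simp add: vec_eq_iff)
    qed
    then have "invertible P"
      using matrix_left_right_inverse by (auto simp: invertible_def)
    then have inv: "P ** matrix_inv P = mat 1" "matrix_inv P ** P = mat 1"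
      unfolding matrix_inv_def invertible_def by (metis (mono_tags, lifting) someI_ex)+
    have "B = P ** A ** matrix_inv P \<longleftrightarrow> B ** P = P ** A"
    proof
      assume "B ** P = P ** A"
      then have "P ** A ** matrix_inv P = B ** (P ** matrix_inv P)"
        by (simp add: matrix_mul_assoc)
      then show "B = P ** A ** matrix_inv P"
        by (simp add: inv)
    qed (simp add: inv flip: matrix_mul_assoc)
    also have "\<dots> \<longleftrightarrow> (\<forall>i j. (B ** P) $ p i $ j = (P ** A) $ p i $ j)"
      unfolding vec_eq_iff using permutes_inverses(1)[OF p] by metis
    also have "\<dots> \<longleftrightarrow> (\<forall>i j. B $ p i $ p j = A $ i $ j)"
    proof -
      have "(B ** P) $ i $ j = B $ i $ p j" for i j
        by (simp add: matrix_matrix_mult_def P if_distrib[of "\<lambda>x. _ * x"] cong: if_cong)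
      moreover have "(P ** A) $ p i $ j = A $ i $ j" for i j
        using permutes_inj[OF p]
        by (simp add: matrix_matrix_mult_def P inj_eq if_distrib[of "\<lambda>x. x * _"] cong: if_cong)
      ultimately show ?thesis
        by simp
    qed
    finally show ?thesis .
  qed
  then show ?thesis
    unfolding equivalent_matrices_def permutation_matrix_def by metis
qed

section \<open>Exhaustive search for perfect colorings\<close>

text \<open>Only colorings up to a renaming of the colors are enumerated: a vertex may receive a color in
  use or the next unused number.  A state \<open>(xs, k, L)\<close> holds the colors of the first vertices, the
  number \<open>k\<close> of colors in use, and a matrix \<open>L\<close> of lower bounds for the color adjacency matrix, in which
  entry \<open>(i, j)\<close> is the largest number of neighbors of color \<open>j\<close> seen so far at a vertex of color \<open>i\<close>.
  In a regular graph of degree \<open>d\<close> a row of \<open>L\<close> whose sum exceeds \<open>d\<close> is contradictory; this pruning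
  is strong enough to keep the search small.

  The levels of the search tree are computed one after the other, with named auxiliary functions
  in place of abstractions: evaluation by rewriting would otherwise unfold the search
  below a binder, where the arguments are not yet known.\<close>

definition color_counts :: "nat \<Rightarrow> nat list \<Rightarrow> nat list \<Rightarrow> nat list" where
  "color_counts m xs ws = map (count_list (map ((!) xs) ws)) [0..<m]"

definition raise_row :: "nat list \<Rightarrow> nat list list \<Rightarrow> nat \<Rightarrow> nat list list" where
  "raise_row r L i = L[i := map2 max (L ! i) r]"

fun refine :: "nat \<Rightarrow> nat list \<Rightarrow> nat \<times> nat list \<Rightarrow> nat list list \<Rightarrow> nat list list" where
  "refine m xs (w, ws) L = raise_row (color_counts m xs ws) L (xs ! w)"

type_synonym state = "nat list \<times> nat \<times> nat list list"

definition child :: "nat \<Rightarrow> (nat \<times> nat list) list \<Rightarrow> nat list \<Rightarrow> nat \<Rightarrow> nat list list \<Rightarrow> nat \<Rightarrow> state" where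
  "child m s xs k L c = (xs @ [c], max k (Suc c), fold (refine m (xs @ [c])) s L)"

fun rows_at_most :: "nat \<Rightarrow> state \<Rightarrow> bool" where
  "rows_at_most d (xs, k, L) = list_all (\<lambda>r. sum_list r \<le> d) L"

fun expand :: "nat \<Rightarrow> nat \<Rightarrow> (nat \<times> nat list) list \<Rightarrow> state \<Rightarrow> state list" where
  "expand m d s (xs, k, L) =
     filter (rows_at_most d) (map (child m s xs k L) [0..<min m (Suc k)])"

definition level :: "nat \<Rightarrow> nat \<Rightarrow> (nat \<times> nat list) list \<Rightarrow> state list \<Rightarrow> state list" where
  "level m d s S = concat (map (expand m d s) S)"

text \<open>When vertex \<open>t\<close> gets its color, new information arises at \<open>t\<close> and at its neighbors among the
  vertices that are already colored.\<close>

definition updates :: "nat list list \<Rightarrow> nat \<Rightarrow> (nat \<times> nat list) list" where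
  "updates adj t = map (\<lambda>w. (w, filter (\<lambda>u. u \<le> t) (adj ! w))) (filter (\<lambda>w. w \<le> t) (t # adj ! t))"

definition search :: "nat \<Rightarrow> nat \<Rightarrow> nat list list \<Rightarrow> state list" where
  "search m d adj =
     fold (level m d) (map (updates adj) [0..<length adj]) [([], 0, replicate m (replicate m 0))]"

text \<open>A state approximates a coloring \<open>f\<close> with matrix \<open>a\<close> if the actual color behind each number \<open>i < k\<close> is
  \<open>rs ! i\<close>.  The list \<open>rs\<close> grows with the search, so the renaming of the colors need not be
  known in advance.\<close>

definition represents ::
    "(nat \<Rightarrow> 'm) \<Rightarrow> ('m \<Rightarrow> 'm \<Rightarrow> nat) \<Rightarrow> 'm list \<Rightarrow> state \<Rightarrow> bool" where
  "represents f a rs = (\<lambda>(xs, k, L). distinct rs \<and> length rs = k \<and>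
     (\<forall>v<length xs. xs ! v < k \<and> f v = rs ! (xs ! v)) \<and>
     length L = CARD('m) \<and> (\<forall>r\<in>set L. length r = CARD('m)) \<and>
     (\<forall>i<CARD('m). \<forall>j<CARD('m). L ! i ! j \<le> (if i < k \<and> j < k then a (rs ! i) (rs ! j) else 0)))"

lemma distinct_length_le_CARD: "distinct (rs :: 'm::finite list) \<Longrightarrow> length rs \<le> CARD('m)"
  by (metis card_mono distinct_card finite subset_UNIV)

lemma count_list_map_inj:
  "inj_on g (insert x (set xs)) \<Longrightarrow> count_list (map g xs) (g x) = count_list xs x"
  by (induction xs) (auto simp: inj_on_def)

lemma count_list_map_filter_le:
  "count_list (map f (filter P xs)) j \<le> count_list (map f xs) j"
  by (induction xs) (auto intro: le_SucI)

text \<open>If the color of the next vertex is not in \<open>rs\<close>, then \<open>rs\<close> with this color is still a list of distinct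
  colors; so a new number is available, and it is the one that the search tries.\<close>

lemma represents_extend:
  fixes f :: "nat \<Rightarrow> 'm::finite"
  assumes rep: "represents f a rs (xs, k, L)"
  obtains rs' c where "c < min (CARD('m)) (Suc k)" "represents f a rs' (xs @ [c], max k (Suc c), L)"
proof (cases "f (length xs) \<in> set rs")
  case True
  then obtain c where "c < k" "f (length xs) = rs ! c"
    using rep by (auto simp: represents_def in_set_conv_nth)
  moreover have "k \<le> CARD('m)"
    using rep distinct_length_le_CARD by (auto simp: represents_def)
  ultimately show ?thesis
    using rep by (intro that[of c rs]) (auto simp: represents_def max_absorb1 nth_append less_Suc_eq)
next
  case False
  then have dist: "distinct (rs @ [f (length xs)])" and k: "length rs = k"
    using rep by (auto simp: represents_def)
  have "Suc k \<le> CARD('m)"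
    using distinct_length_le_CARD[OF dist] k by simp
  moreover have "L ! i ! j \<le> (if i < Suc k \<and> j < Suc k
      then a ((rs @ [f (length xs)]) ! i) ((rs @ [f (length xs)]) ! j) else 0)"
    if "i < CARD('m)" "j < CARD('m)" for i j
  proof -
    have "L ! i ! j \<le> (if i < k \<and> j < k then a (rs ! i) (rs ! j) else 0)"
      using rep that by (simp add: represents_def)
    then show ?thesis
      using k by (auto simp: nth_append split: if_splits)
  qed
  ultimately show ?thesis
    using rep dist k
    by (intro that[of k "rs @ [f (length xs)]"]) (auto simp: represents_def nth_append less_Suc_eq)
qed

lemma represents_refine:
  fixes f :: "nat \<Rightarrow> 'm::finite"
  assumes rep: "represents f a rs (xs, k, L)"
    and w: "w < length xs" "set ws \<subseteq> {..<length xs}"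
    and count: "\<And>j. count_list (map f ws) j \<le> a (f w) j"
  shows "represents f a rs (xs, k, refine (CARD('m)) xs (w, ws) L)"
proof -
  have dist: "distinct rs" and k: "length rs = k" "k \<le> CARD('m)"
    and xs: "\<And>v. v < length xs \<Longrightarrow> xs ! v < k \<and> f v = rs ! (xs ! v)"
    and L: "length L = CARD('m)" "\<And>i. i < CARD('m) \<Longrightarrow> length (L ! i) = CARD('m)"
      "\<And>i j. i < CARD('m) \<Longrightarrow> j < CARD('m) \<Longrightarrow> L ! i ! j \<le> (if i < k \<and> j < k then a (rs ! i) (rs ! j) else 0)"
    using rep distinct_length_le_CARD[of rs] by (auto simp: represents_def)
  have map_f: "map f ws = map ((!) rs) (map ((!) xs) ws)"
    using xs w(2) by auto
  have counts: "count_list (map ((!) xs) ws) j \<le> (if j < k then a (rs ! (xs ! w)) (rs ! j) else 0)" for j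
  proof (cases "j < k")
    case True
    have "inj_on ((!) rs) (insert j (set (map ((!) xs) ws)))"
      using dist by (rule inj_on_nth) (use k xs w(2) True in auto)
    then show ?thesis
      using count[of "rs ! j"] xs[OF w(1)] True by (simp add: map_f count_list_map_inj del: map_map)
  next
    case False
    then have "j \<notin> set (map ((!) xs) ws)"
      using xs w(2) by fastforce
    then show ?thesis
      by (simp add: count_list_0_iff)
  qed
  define L' where "L' = refine (CARD('m)) xs (w, ws) L"
  have L'_nth: "L' ! i ! j = (if i = xs ! w then max (L ! i ! j) (count_list (map ((!) xs) ws) j) else L ! i ! j)"
    if "i < CARD('m)" "j < CARD('m)" for i j
    using that L xs[OF w(1)] k
    by (auto simp: L'_def raise_row_def color_counts_def nth_list_update)
  have "L' ! i ! j \<le> (if i < k \<and> j < k then a (rs ! i) (rs ! j) else 0)"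
    if "i < CARD('m)" "j < CARD('m)" for i j
    using L(3)[OF that] counts[of j] xs[OF w(1)] by (auto simp: L'_nth that split: if_splits)
  moreover have "length L' = CARD('m)" "\<forall>r\<in>set L'. length r = CARD('m)"
    using L(1,2) xs[OF w(1)] k
    by (auto simp: L'_def raise_row_def color_counts_def in_set_conv_nth nth_list_update)
  ultimately show ?thesis
    using dist k xs by (simp add: represents_def L'_def)
qed

lemma represents_fold_refine:
  fixes f :: "nat \<Rightarrow> 'm::finite"
  assumes "represents f a rs (xs, k, L)"
    and "\<And>w ws. (w, ws) \<in> set s \<Longrightarrow> w < length xs \<and> set ws \<subseteq> {..<length xs} \<and>
           (\<forall>j. count_list (map f ws) j \<le> a (f w) j)"
  shows "represents f a rs (xs, k, fold (refine (CARD('m)) xs) s L)"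
  using assms
proof (induction s arbitrary: L)
  case (Cons p s)
  obtain w ws where p: "p = (w, ws)"
    by (cases p)
  have "represents f a rs (xs, k, refine (CARD('m)) xs p L)"
    unfolding p using Cons.prems p by (intro represents_refine) auto
  from Cons.IH[OF this] Cons.prems(2) show ?case
    by (metis fold_simps(2) list.set_intros(2))
qed simp

lemma sum_color_row:
  assumes "index_coloring adj f a" "v < length adj" "length (adj ! v) = d"
  shows "(\<Sum>j\<in>(UNIV :: 'm::finite set). a (f v :: 'm) j) = d"
proof -
  have "(\<Sum>j\<in>UNIV. a (f v) j) = (\<Sum>j\<in>UNIV. count_list (map f (adj ! v)) j)"
    using assms(1,2) by (simp add: index_coloring_def)
  also have "\<dots> = (\<Sum>j\<in>set (map f (adj ! v)). count_list (map f (adj ! v)) j)"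
    by (intro sum.mono_neutral_right) (auto simp: count_list_0_iff)
  finally show ?thesis
    using assms(3) by (simp add: sum_count_set)
qed

lemma represents_rows_at_most:
  fixes f :: "nat \<Rightarrow> 'm::finite"
  assumes rep: "represents f a rs (xs, k, L)"
    and reg: "\<And>i. (\<Sum>j\<in>UNIV. a i j) \<le> d"
  shows "rows_at_most d (xs, k, L)"
proof -
  have dist: "distinct rs" and k: "length rs = k" "k \<le> CARD('m)"
    and L: "length L = CARD('m)" "\<And>i. i < CARD('m) \<Longrightarrow> length (L ! i) = CARD('m)"
      "\<And>i j. i < CARD('m) \<Longrightarrow> j < CARD('m) \<Longrightarrow> L ! i ! j \<le> (if i < k \<and> j < k then a (rs ! i) (rs ! j) else 0)"
    using rep distinct_length_le_CARD[of rs] by (auto simp: represents_def)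
  have "sum_list (L ! i) \<le> d" if i: "i < CARD('m)" for i
  proof -
    have "sum_list (L ! i) = (\<Sum>j<CARD('m). L ! i ! j)"
      using L(2)[OF i] by (simp add: sum_list_sum_nth atLeast0LessThan)
    also have "\<dots> \<le> (\<Sum>j<CARD('m). if j < k then a (rs ! i) (rs ! j) else 0)"
      using L(3)[OF i] by (intro sum_mono) (force split: if_splits)
    also have "\<dots> = (\<Sum>j<k. a (rs ! i) (rs ! j))"
      using k(2) by (intro sum.mono_neutral_cong_right) auto
    also have "\<dots> = (\<Sum>j\<in>set rs. a (rs ! i) j)"
      using dist k by (intro sum.reindex_bij_betw bij_betw_nth) auto
    also have "\<dots> \<le> (\<Sum>j\<in>UNIV. a (rs ! i) j)"
      by (intro sum_mono2) auto
    finally show ?thesis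
      using reg[of "rs ! i"] by simp
  qed
  then show ?thesis
    using L(1) by (auto simp: list_all_iff in_set_conv_nth)
qed

text \<open>Following a given coloring down the search tree, none of its states is pruned, because the
  lower bounds stay below the true matrix, whose rows sum to \<open>d\<close>.\<close>

lemma search_complete:
  fixes f :: "nat \<Rightarrow> 'm::finite"
  assumes col: "index_coloring adj f a"
    and adj: "\<And>v. v < length adj \<Longrightarrow> set (adj ! v) \<subseteq> {..<length adj}"
    and reg: "\<And>v. v < length adj \<Longrightarrow> length (adj ! v) = d"
  obtains xs k L rs where "(xs, k, L) \<in> set (search (CARD('m)) d adj)"
    "length xs = length adj" "represents f a rs (xs, k, L)"
proof -
  define S where "S t = fold (level (CARD('m)) d) (map (updates adj) [0..<t])
    [([], 0, replicate (CARD('m)) (replicate (CARD('m)) 0))]" for t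
  have row: "(\<Sum>j\<in>UNIV. a i j) \<le> d" for i
  proof -
    have "i \<in> f ` {..<length adj}"
      using col by (simp add: index_coloring_def)
    then show ?thesis
      using sum_color_row[OF col] reg by fastforce
  qed
  have "\<exists>xs k L rs. (xs, k, L) \<in> set (S t) \<and> length xs = t \<and> represents f a rs (xs, k, L)"
    if "t \<le> length adj" for t
    using that
  proof (induction t)
    case 0
    then show ?case
      by (auto simp: S_def represents_def)
  next
    case (Suc t)
    then obtain xs k L rs where st: "(xs, k, L) \<in> set (S t)" "length xs = t"
      and rep: "represents f a rs (xs, k, L)"
      by auto
    obtain rs' c where c: "c < min (CARD('m)) (Suc k)"
      and rep': "represents f a rs' (xs @ [c], max k (Suc c), L)"
      using represents_extend[OF rep] by metis
    have "represents f a rs' (child (CARD('m)) (updates adj t) xs k L c)"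
      unfolding child_def
    proof (rule represents_fold_refine[OF rep'])
      fix w ws assume "(w, ws) \<in> set (updates adj t)"
      then have w: "w \<le> t" and ws: "ws = filter (\<lambda>u. u \<le> t) (adj ! w)"
        by (auto simp: updates_def)
      have "count_list (map f ws) j \<le> count_list (map f (adj ! w)) j" for j
        unfolding ws by (rule count_list_map_filter_le)
      then show "w < length (xs @ [c]) \<and> set ws \<subseteq> {..<length (xs @ [c])} \<and>
          (\<forall>j. count_list (map f ws) j \<le> a (f w) j)"
        using w ws st(2) Suc.prems col by (auto simp: index_coloring_def)
    qed
    moreover from this have "rows_at_most d (child (CARD('m)) (updates adj t) xs k L c)"
      using represents_rows_at_most[OF _ row] by (simp add: child_def)
    moreover have "S (Suc t) = level (CARD('m)) d (updates adj t) (S t)"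
      by (simp add: S_def)
    ultimately have "child (CARD('m)) (updates adj t) xs k L c \<in> set (S (Suc t))"
      using st(1) c by (auto simp: level_def intro!: bexI[of _ "(xs, k, L)"])
    then show ?case
      using \<open>represents f a rs' (child (CARD('m)) (updates adj t) xs k L c)\<close> st(2)
      unfolding child_def by (metis length_append_singleton)
  qed
  then show ?thesis
    using that unfolding search_def S_def by blast
qed

definition row_perms :: "nat \<Rightarrow> nat list list" where
  "row_perms m = filter distinct (List.n_lists m [0..<m])"

definition permuted :: "nat list list \<Rightarrow> nat list \<Rightarrow> nat list list" where
  "permuted L s = map (\<lambda>i. map ((!) (L ! i)) s) s"

text \<open>The permutations \<open>ps\<close> of the row indices are passed on as an argument, so that evaluation computes them
  only once.\<close>

definition listed :: "nat list list \<Rightarrow> nat list list list \<Rightarrow> nat list list \<Rightarrow> bool" where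
  "listed ps Ms L \<longleftrightarrow> list_ex (\<lambda>s. permuted L s \<in> set Ms) ps"

fun leaf_ok :: "nat \<Rightarrow> nat \<Rightarrow> nat list list \<Rightarrow> nat list list list \<Rightarrow> state \<Rightarrow> bool" where
  "leaf_ok m d ps Ms (xs, k, L) \<longleftrightarrow> k \<noteq> m \<or> list_all (\<lambda>r. sum_list r = d) L \<and> listed ps Ms L"

definition search_check :: "nat \<Rightarrow> nat \<Rightarrow> nat list list \<Rightarrow> nat list list list \<Rightarrow> bool" where
  "search_check m d adj Ms \<longleftrightarrow> list_all (\<lambda>ws. length ws = d) adj \<and>
     list_all (leaf_ok m d (row_perms m) Ms) (search m d adj)"

text \<open>A certificate that a matrix occurs: \<open>xs\<close> lists the colors of the vertices.\<close>

definition realizes :: "nat \<Rightarrow> nat list list \<Rightarrow> nat list list \<Rightarrow> nat list \<Rightarrow> bool" where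
  "realizes m adj M xs \<longleftrightarrow> length xs = length adj \<and> list_all (\<lambda>c. c < m) xs \<and>
     list_all (\<lambda>c. c \<in> set xs) [0..<m] \<and>
     list_all (\<lambda>v. color_counts m xs (adj ! v) = M ! (xs ! v)) [0..<length adj]"

text \<open>By the check, the bounds at a complete coloring with all colors have row sums \<open>d\<close>, like the true
  matrix; so the bounds are attained.\<close>

lemma search_check_imp:
  fixes f :: "nat \<Rightarrow> 'm::finite"
  assumes col: "index_coloring adj f a" and chk: "search_check (CARD('m)) d adj Ms"
    and adj: "\<And>v. v < length adj \<Longrightarrow> set (adj ! v) \<subseteq> {..<length adj}"
  obtains M rs where "M \<in> set Ms" "distinct rs" "length rs = CARD('m)"
    "\<And>i j. i < CARD('m) \<Longrightarrow> j < CARD('m) \<Longrightarrow> M ! i ! j = a (rs ! i) (rs ! j)"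
proof -
  let ?m = "CARD('m)"
  have reg: "length (adj ! v) = d" if "v < length adj" for v
    using chk that by (simp add: search_check_def list_all_length)
  obtain xs k L rs where st: "(xs, k, L) \<in> set (search ?m d adj)" "length xs = length adj"
    and rep: "represents f a rs (xs, k, L)"
    using search_complete[OF col adj reg] by metis
  have dist: "distinct rs" and k: "length rs = k"
    and xs: "\<And>v. v < length adj \<Longrightarrow> xs ! v < k \<and> f v = rs ! (xs ! v)"
    and L: "length L = ?m" "\<And>i. i < ?m \<Longrightarrow> length (L ! i) = ?m"
    using rep st(2) by (auto simp: represents_def)
  have "UNIV \<subseteq> set rs"
    using col xs k unfolding index_coloring_def by (metis image_subsetI lessThan_iff nth_mem)
  then have rs: "set rs = UNIV"
    by auto
  then have km: "k = ?m"
    using dist k by (metis distinct_card)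
  then have le: "L ! i ! j \<le> a (rs ! i) (rs ! j)" if "i < ?m" "j < ?m" for i j
    using rep that by (simp add: represents_def)
  have leaf: "leaf_ok ?m d (row_perms ?m) Ms (xs, k, L)"
    using chk st(1) unfolding search_check_def list_all_iff by blast
  have eq: "L ! i ! j = a (rs ! i) (rs ! j)" if ij: "i < ?m" "j < ?m" for i j
  proof (rule ccontr)
    assume "L ! i ! j \<noteq> a (rs ! i) (rs ! j)"
    then have "(\<Sum>j<?m. L ! i ! j) < (\<Sum>j<?m. a (rs ! i) (rs ! j))"
      using le ij by (intro sum_strict_mono_ex1) (auto intro!: bexI[of _ j] simp: order_less_le)
    also have "\<dots> = (\<Sum>j\<in>UNIV. a (rs ! i) j)"
      using dist k km rs by (intro sum.reindex_bij_betw bij_betw_nth) auto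
    also have "\<dots> = d"
    proof -
      have "rs ! i \<in> f ` {..<length adj}"
        using col by (simp add: index_coloring_def)
      then show ?thesis
        using sum_color_row[OF col] reg by fastforce
    qed
    finally have "sum_list (L ! i) < d"
      using L(2)[OF ij(1)] by (simp add: sum_list_sum_nth atLeast0LessThan)
    moreover have "sum_list (L ! i) = d"
      using leaf km ij(1) L(1) by (simp add: list_all_length)
    ultimately show False
      by simp
  qed
  obtain s where s: "s \<in> set (row_perms ?m)" "permuted L s \<in> set Ms"
    using leaf km by (auto simp: listed_def list_ex_iff)
  have s_props: "distinct s" "length s = ?m" "\<And>i. i < ?m \<Longrightarrow> s ! i < ?m"
    using s(1) by (auto simp: row_perms_def set_n_lists subset_iff)
  show ?thesis
  proof (rule that[OF s(2)])
    show "distinct (map ((!) rs) s)"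
      using s_props dist k km by (auto simp: distinct_map in_set_conv_nth intro!: inj_on_nth)
    show "permuted L s ! i ! j = a (map ((!) rs) s ! i) (map ((!) rs) s ! j)"
      if "i < ?m" "j < ?m" for i j
      using that s_props eq by (simp add: permuted_def)
  qed (simp add: s_props)
qed

section \<open>Matrices of perfect 4-colorings\<close>

text \<open>The numeral type has \<open>4 = 0\<close>, so the rows of a vector literal are enumerated by 1, 2, 3, 4 and the
  list index is shifted by one.\<close>

definition index4 :: "nat \<Rightarrow> 4" where
  "index4 i = of_nat (Suc i)"

definition matrix4 :: "nat list list \<Rightarrow> real^4^4" where
  "matrix4 M = vector (map (\<lambda>r. vector (map real r)) M)"

lemma index4_simps: "index4 0 = 1" "index4 1 = 2" "index4 2 = 3" "index4 3 = 4"
  by (simp_all add: index4_def)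

lemma bij_index4: "bij_betw index4 {..<4} UNIV"
proof -
  have "index4 ` {..<4} = UNIV"
    unfolding UNIV_4 by (auto simp: index4_simps numeral_eq_Suc lessThan_Suc index4_def)
  then show ?thesis
    by (simp add: bij_betw_def eq_card_imp_inj_on)
qed

lemma vector_4_nth:
  assumes "length l = 4" "i < 4"
  shows "(vector l :: 'a::zero^4) $ index4 i = l ! i"
proof -
  obtain a b c e where l: "l = [a, b, c, e]"
    using assms(1) by (auto simp: numeral_eq_Suc length_Suc_conv)
  have neq: "(1::4) \<noteq> 2" "(1::4) \<noteq> 3" "(1::4) \<noteq> 4" "(2::4) \<noteq> 3" "(2::4) \<noteq> 4" "(3::4) \<noteq> 4"
    by simp_all
  have "i = 0 \<or> i = 1 \<or> i = 2 \<or> i = 3"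
    using assms(2) by auto
  then show ?thesis
    using neq by (elim disjE) (simp_all only: l vector_def index4_simps, simp_all)
qed

lemma matrix4_nth:
  assumes "length M = 4" "\<forall>r\<in>set M. length r = 4" "i < 4" "j < 4"
  shows "matrix4 M $ index4 i $ index4 j = real (M ! i ! j)"
  using assms by (simp add: matrix4_def vector_4_nth)

text \<open>Every perfect coloring is found by the search, which gives one direction.  For the other, a
  coloring that realizes a listed matrix also realizes, after a permutation of its colors, every
  equivalent matrix.\<close>

lemma perfect_coloring_matrices_iff_listed:
  fixes A :: "real^4^4"
  assumes G: "indexed_graph G \<phi> adj"
    and Ms: "list_all (\<lambda>M. length M = 4 \<and> list_all (\<lambda>r. length r = 4) M) Ms"
    and chk: "search_check 4 d adj Ms"
    and real: "list_all2 (realizes 4 adj) Ms Xs"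
  shows "A \<in> perfect_coloring_matrices G \<longleftrightarrow> (\<exists>B\<in>matrix4 ` set Ms. equivalent_matrices A B)"
proof -
  have adj: "set (adj ! v) \<subseteq> {..<length adj}" if "v < length adj" for v
    using G that by (simp add: indexed_graph_def)
  have nth: "matrix4 M $ index4 i $ index4 j = real (M ! i ! j)"
    if "M \<in> set Ms" "i < 4" "j < 4" for M i j
    using Ms that by (intro matrix4_nth) (auto simp: list_all_iff)
  have surj: "\<exists>k<4. i = index4 k" for i
    using bij_index4 by (fastforce simp: bij_betw_def)
  show ?thesis
  proof
    assume "A \<in> perfect_coloring_matrices G"
    then obtain f and a :: "4 \<Rightarrow> 4 \<Rightarrow> nat" where col: "index_coloring adj f a"
      and A: "A = (\<chi> i j. real (a i j))"
      using perfect_coloring_matrices_iff[OF G] by blast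
    have "search_check (CARD(4)) d adj Ms"
      using chk by simp
    from search_check_imp[OF col this adj] obtain M rs where M: "M \<in> set Ms"
      and rs: "distinct rs" "length rs = 4"
      and eq: "\<And>i j. i < 4 \<Longrightarrow> j < 4 \<Longrightarrow> M ! i ! j = a (rs ! i) (rs ! j)"
      by (auto simp: card_bit0)
    have bij_rs: "bij_betw ((!) rs) {..<4} (set rs)"
      using rs by (intro bij_betw_nth) auto
    moreover have "set rs = UNIV"
      using rs by (intro card_subset_eq) (auto simp: distinct_card)
    ultimately have bij: "bij_betw ((!) rs \<circ> inv_into {..<4} index4) UNIV UNIV"
      using bij_betw_trans[OF bij_betw_inv_into[OF bij_index4]] by simp
    define q where "q = (!) rs \<circ> inv_into {..<4} index4"
    have q: "q permutes UNIV"
      unfolding q_def using bij by (intro bij_imp_permutes) auto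
    have q_nth: "q (index4 i) = rs ! i" if "i < 4" for i
      using that bij_index4 by (simp add: q_def bij_betw_def inv_into_f_f)
    have "matrix4 M $ i $ j = A $ q i $ q j" for i j
      using surj[of i] surj[of j] nth[OF M] eq by (auto simp: A q_nth)
    then have "equivalent_matrices A (matrix4 M)"
      unfolding equivalent_matrices_iff using q
      by (intro exI[of _ "inv q"]) (simp add: permutes_inv permutes_inverses)
    then show "\<exists>B\<in>matrix4 ` set Ms. equivalent_matrices A B"
      using M by blast
  next
    assume "\<exists>B\<in>matrix4 ` set Ms. equivalent_matrices A B"
    then obtain M p where M: "M \<in> set Ms" and p: "p permutes UNIV"
      and eq: "\<And>i j. matrix4 M $ p i $ p j = A $ i $ j"
      by (auto simp: equivalent_matrices_iff)
    obtain xs where xs: "realizes 4 adj M xs"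
      using M real by (auto simp: list_all2_conv_all_nth in_set_conv_nth)
    have less: "xs ! v < 4" if "v < length adj" for v
      using xs that by (simp add: realizes_def list_all_length)
    define f where "f v = inv p (index4 (xs ! v))" for v
    \<comment> \<open>The entries of \<open>A\<close> are naturals, being a rearrangement of those of \<open>M\<close>.\<close>
    define a where "a i j = nat \<lfloor>A $ i $ j\<rfloor>" for i j
    have A_nth: "A $ inv p (index4 i) $ inv p (index4 j) = real (M ! i ! j)" if "i < 4" "j < 4" for i j
      using eq[of "inv p (index4 i)" "inv p (index4 j)"] nth[OF M that] permutes_inverses(1)[OF p]
      by simp
    have a: "a (inv p (index4 i)) (inv p (index4 j)) = M ! i ! j" if "i < 4" "j < 4" for i j
      by (simp add: a_def A_nth that)
    have surj': "\<exists>k<4. i = inv p (index4 k)" for i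
    proof -
      obtain k where "k < 4" "p i = index4 k"
        using surj by blast
      then show ?thesis
        using permutes_inverses(2)[OF p, of i] by auto
    qed
    have "index_coloring adj f a"
      unfolding index_coloring_def
    proof (intro conjI allI impI)
      have "\<exists>v<length adj. f v = i" for i
      proof -
        obtain c where c: "c < 4" "i = inv p (index4 c)"
          using surj' by blast
        then have "c \<in> set xs"
          using xs by (auto simp: realizes_def list_all_iff)
        then show ?thesis
          using xs c(2) by (auto simp: f_def realizes_def in_set_conv_nth)
      qed
      then show "f ` {..<length adj} = UNIV"
        by (auto simp: set_eq_iff image_iff) (metis lessThan_iff)
      show "count_list (map f (adj ! v)) j = a (f v) j" if v: "v < length adj" for v j
      proof -
        obtain c where c: "c < 4" "j = inv p (index4 c)"
          using surj' by blast
        define g where "g = inv p \<circ> index4"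
        have "inj_on (inv p) (index4 ` {..<4})"
          using permutes_inj[OF permutes_inv[OF p]] by (rule inj_on_subset) simp
        moreover have "inj_on index4 {..<4}"
          using bij_index4 by (rule bij_betw_imp_inj_on)
        ultimately have inj: "inj_on g {..<4}"
          unfolding g_def by (intro comp_inj_on)
        have map_f: "map f (adj ! v) = map g (map ((!) xs) (adj ! v))"
          by (simp add: f_def g_def)
        have "insert c (set (map ((!) xs) (adj ! v))) \<subseteq> {..<4}"
          using c(1) adj[OF v] less by auto
        from count_list_map_inj[OF inj_on_subset[OF inj this]]
        have "count_list (map f (adj ! v)) j = count_list (map ((!) xs) (adj ! v)) c"
          unfolding map_f c(2) g_def by simp
        also have "\<dots> = color_counts 4 xs (adj ! v) ! c"
          using c(1) by (simp add: color_counts_def)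
        also have "\<dots> = M ! (xs ! v) ! c"
          using xs v by (simp add: realizes_def list_all_iff)
        also have "\<dots> = a (f v) j"
          using a[OF less[OF v] c(1)] by (simp add: f_def c(2))
        finally show ?thesis .
      qed
    qed
    moreover have "A = (\<chi> i j. real (a i j))"
    proof -
      have "A $ i $ j = real (a i j)" for i j
        using surj'[of i] surj'[of j] a A_nth by auto
      then show ?thesis
        by (simp add: vec_eq_iff)
    qed
    ultimately show "A \<in> perfect_coloring_matrices G"
      unfolding perfect_coloring_matrices_iff[OF G] by blast
  qed
qed

section \<open>The five solids\<close>

lemma golden_ratio_inverse: "1 / golden_ratio = golden_ratio - 1" "-1 / golden_ratio = 1 - golden_ratio"
  using golden_ratio_pos golden_ratio_square by (simp_all add: field_simps)

lemma golden_ratio_bounds: "1 < golden_ratio" "golden_ratio < 2"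
proof -
  have "1 < sqrt 5" "sqrt 5 < 3"
    by (auto intro: real_less_lsqrt)
  then show "1 < golden_ratio" "golden_ratio < 2"
    by (simp_all add: golden_ratio_def)
qed

lemma sign_points_eq:
  "{vector [a, b, c] :: real^3 | a b c. a \<in> {-1, 1} \<and> b \<in> {-1, 1} \<and> c \<in> {-1, 1}} =
   (\<Union>a\<in>{-1, 1}. \<Union>b\<in>{-1, 1}. \<Union>c\<in>{-1, 1}. {vector [a, b, c]})"
  by blast

text \<open>The vertices are listed in an order in which closed neighborhoods fill up early, so that the
  search meets contradictions soon.\<close>

definition tetrahedron_vertices :: "golden_point list" where
  "tetrahedron_vertices =
    [((1, 0), (1, 0), (1, 0)), ((1, 0), (-1, 0), (-1, 0)), ((-1, 0), (1, 0), (-1, 0)),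
     ((-1, 0), (-1, 0), (1, 0))]"

definition tetrahedron_matrices :: "nat list list list" where
  "tetrahedron_matrices =
    [[[0, 1, 1, 1], [1, 0, 1, 1], [1, 1, 0, 1], [1, 1, 1, 0]]]"

lemma tetrahedron_eq: "tetrahedron = convex hull (golden_vec ` set tetrahedron_vertices)"
  by (simp add: tetrahedron_def tetrahedron_vertices_def golden_vec_def golden_val_def)

lemma solid_check_tetrahedron:
  "solid_check tetrahedron_vertices (3, 0) (-1, 0) []"
  by code_simp

lemma realizes_tetrahedron:
  "list_all2 (realizes 4 (adjacency tetrahedron_vertices (-1, 0))) tetrahedron_matrices
    [[0, 1, 2, 3]]"
  by code_simp

lemma search_check_tetrahedron:
  "search_check 4 3 (adjacency tetrahedron_vertices (-1, 0)) tetrahedron_matrices"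
  by code_simp

lemma tetrahedron_matrices_iff:
  "A \<in> perfect_coloring_matrices (edge_graph tetrahedron) \<longleftrightarrow>
    (\<exists>B\<in>matrix4 ` set tetrahedron_matrices. equivalent_matrices A B)"
  unfolding tetrahedron_eq
proof (rule perfect_coloring_matrices_iff_listed)
  show "indexed_graph (edge_graph (convex hull (golden_vec ` set tetrahedron_vertices)))
      (\<lambda>i. golden_vec (tetrahedron_vertices ! i)) (adjacency tetrahedron_vertices (-1, 0))"
    by (rule indexed_graph_golden_vec[OF solid_check_tetrahedron])
      (use golden_ratio_bounds in \<open>auto simp: golden_val_def\<close>)
qed (rule search_check_tetrahedron realizes_tetrahedron | simp add: tetrahedron_matrices_def)+

definition cube_vertices :: "golden_point list" where
  "cube_vertices =
    [((1, 0), (1, 0), (1, 0)), ((1, 0), (1, 0), (-1, 0)), ((1, 0), (-1, 0), (1, 0)),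
     ((-1, 0), (1, 0), (1, 0)), ((1, 0), (-1, 0), (-1, 0)), ((-1, 0), (1, 0), (-1, 0)),
     ((-1, 0), (-1, 0), (1, 0)), ((-1, 0), (-1, 0), (-1, 0))]"

definition cube_matrices :: "nat list list list" where
  "cube_matrices =
    [[[0, 0, 0, 3], [0, 0, 3, 0], [0, 1, 0, 2], [1, 0, 2, 0]],
     [[0, 0, 1, 2], [0, 0, 2, 1], [1, 2, 0, 0], [2, 1, 0, 0]],
     [[0, 1, 1, 1], [1, 0, 1, 1], [1, 1, 0, 1], [1, 1, 1, 0]],
     [[0, 1, 1, 1], [1, 0, 1, 1], [1, 1, 1, 0], [1, 1, 0, 1]],
     [[1, 0, 1, 1], [0, 1, 1, 1], [1, 1, 1, 0], [1, 1, 0, 1]]]"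

lemma cube_eq: "cube = convex hull (golden_vec ` set cube_vertices)"
  unfolding cube_def sign_points_eq
  by (rule arg_cong[where f = "\<lambda>V. convex hull V"],
      simp add: cube_vertices_def golden_vec_def golden_val_def) blast

lemma solid_check_cube:
  "solid_check cube_vertices (3, 0) (1, 0) [(-1, 0), (-3, 0)]"
  by code_simp

lemma realizes_cube:
  "list_all2 (realizes 4 (adjacency cube_vertices (1, 0))) cube_matrices
    [[0, 3, 3, 3, 2, 2, 2, 1],
     [0, 3, 3, 2, 0, 1, 1, 2],
     [0, 1, 2, 3, 3, 2, 1, 0],
     [2, 2, 0, 1, 1, 0, 3, 3],
     [0, 0, 2, 3, 2, 3, 1, 1]]"
  by code_simp

lemma search_check_cube:
  "search_check 4 3 (adjacency cube_vertices (1, 0)) cube_matrices"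
  by code_simp

lemma cube_matrices_iff:
  "A \<in> perfect_coloring_matrices (edge_graph cube) \<longleftrightarrow>
    (\<exists>B\<in>matrix4 ` set cube_matrices. equivalent_matrices A B)"
  unfolding cube_eq
proof (rule perfect_coloring_matrices_iff_listed)
  show "indexed_graph (edge_graph (convex hull (golden_vec ` set cube_vertices)))
      (\<lambda>i. golden_vec (cube_vertices ! i)) (adjacency cube_vertices (1, 0))"
    by (rule indexed_graph_golden_vec[OF solid_check_cube])
      (use golden_ratio_bounds in \<open>auto simp: golden_val_def\<close>)
qed (rule search_check_cube realizes_cube | simp add: cube_matrices_def)+

definition octahedron_vertices :: "golden_point list" where
  "octahedron_vertices =
    [((1, 0), (0, 0), (0, 0)), ((0, 0), (1, 0), (0, 0)), ((0, 0), (0, 0), (1, 0)),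
     ((0, 0), (-1, 0), (0, 0)), ((0, 0), (0, 0), (-1, 0)), ((-1, 0), (0, 0), (0, 0))]"

definition octahedron_matrices :: "nat list list list" where
  "octahedron_matrices =
    [[[0, 0, 2, 2], [0, 0, 2, 2], [1, 1, 0, 2], [1, 1, 2, 0]],
     [[0, 0, 2, 2], [0, 0, 2, 2], [1, 1, 1, 1], [1, 1, 1, 1]]]"

lemma octahedron_eq: "octahedron = convex hull (golden_vec ` set octahedron_vertices)"
  unfolding octahedron_def
  by (rule arg_cong[where f = "\<lambda>V. convex hull V"],
      simp add: octahedron_vertices_def golden_vec_def golden_val_def) blast

lemma solid_check_octahedron:
  "solid_check octahedron_vertices (1, 0) (0, 0) [(-1, 0)]"
  by code_simp

lemma realizes_octahedron:
  "list_all2 (realizes 4 (adjacency octahedron_vertices (0, 0))) octahedron_matrices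
    [[0, 2, 3, 2, 3, 1],
     [2, 2, 0, 3, 1, 3]]"
  by code_simp

lemma search_check_octahedron:
  "search_check 4 4 (adjacency octahedron_vertices (0, 0)) octahedron_matrices"
  by code_simp

lemma octahedron_matrices_iff:
  "A \<in> perfect_coloring_matrices (edge_graph octahedron) \<longleftrightarrow>
    (\<exists>B\<in>matrix4 ` set octahedron_matrices. equivalent_matrices A B)"
  unfolding octahedron_eq
proof (rule perfect_coloring_matrices_iff_listed)
  show "indexed_graph (edge_graph (convex hull (golden_vec ` set octahedron_vertices)))
      (\<lambda>i. golden_vec (octahedron_vertices ! i)) (adjacency octahedron_vertices (0, 0))"
    by (rule indexed_graph_golden_vec[OF solid_check_octahedron])
      (use golden_ratio_bounds in \<open>auto simp: golden_val_def\<close>)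
qed (rule search_check_octahedron realizes_octahedron | simp add: octahedron_matrices_def)+

definition dodecahedron_vertices :: "golden_point list" where
  "dodecahedron_vertices =
    [((1, 0), (1, 0), (1, 0)), ((0, 0), (-1, 1), (0, 1)), ((-1, 1), (0, 1), (0, 0)),
     ((0, 1), (0, 0), (-1, 1)), ((-1, 0), (1, 0), (1, 0)), ((0, 0), (1, -1), (0, 1)),
     ((1, 0), (1, 0), (-1, 0)), ((1, -1), (0, 1), (0, 0)), ((0, -1), (0, 0), (-1, 1)),
     ((-1, 0), (1, 0), (-1, 0)), ((1, 0), (-1, 0), (1, 0)), ((0, 1), (0, 0), (1, -1)),
     ((-1, 0), (-1, 0), (1, 0)), ((0, 0), (-1, 1), (0, -1)), ((0, -1), (0, 0), (1, -1)),
     ((-1, 1), (0, -1), (0, 0)), ((1, 0), (-1, 0), (-1, 0)), ((1, -1), (0, -1), (0, 0)),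
     ((0, 0), (1, -1), (0, -1)), ((-1, 0), (-1, 0), (-1, 0))]"

definition dodecahedron_matrices :: "nat list list list" where
  "dodecahedron_matrices =
    [[[0, 0, 0, 3], [0, 0, 2, 1], [0, 2, 0, 1], [1, 1, 1, 0]],
     [[0, 0, 0, 3], [0, 1, 1, 1], [0, 1, 1, 1], [1, 1, 1, 0]],
     [[0, 0, 1, 2], [0, 0, 1, 2], [1, 1, 1, 0], [1, 1, 0, 1]],
     [[0, 0, 1, 2], [0, 2, 0, 1], [1, 0, 2, 0], [2, 1, 0, 0]],
     [[1, 0, 0, 2], [0, 1, 0, 2], [0, 0, 1, 2], [1, 1, 1, 0]]]"

lemma dodecahedron_eq: "dodecahedron = convex hull (golden_vec ` set dodecahedron_vertices)"
  unfolding dodecahedron_def sign_points_eq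
  by (rule arg_cong[where f = "\<lambda>V. convex hull V"],
      simp add: dodecahedron_vertices_def golden_vec_def golden_val_def golden_ratio_inverse del: minus_divide_left) blast

lemma solid_check_dodecahedron:
  "solid_check dodecahedron_vertices (3, 0) (-1, 2) [(1, 0), (-1, 0), (1, -2), (-3, 0)]"
  by code_simp

lemma realizes_dodecahedron:
  "list_all2 (realizes 4 (adjacency dodecahedron_vertices (-1, 2))) dodecahedron_matrices
    [[0, 3, 3, 3, 1, 2, 1, 2, 2, 1, 1, 2, 1, 2, 3, 2, 1, 3, 3, 0],
     [1, 1, 2, 3, 3, 2, 3, 2, 0, 1, 2, 0, 3, 1, 3, 1, 3, 1, 2, 2],
     [3, 3, 0, 1, 1, 0, 3, 2, 3, 2, 2, 3, 3, 1, 0, 2, 0, 1, 3, 3],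
     [1, 1, 1, 3, 1, 3, 3, 1, 3, 3, 0, 0, 0, 0, 0, 2, 2, 2, 2, 2],
     [0, 0, 3, 3, 3, 3, 1, 2, 1, 2, 2, 1, 1, 3, 3, 2, 3, 3, 0, 0]]"
  by code_simp

lemma search_check_dodecahedron:
  "search_check 4 3 (adjacency dodecahedron_vertices (-1, 2)) dodecahedron_matrices"
  by code_simp

lemma dodecahedron_matrices_iff:
  "A \<in> perfect_coloring_matrices (edge_graph dodecahedron) \<longleftrightarrow>
    (\<exists>B\<in>matrix4 ` set dodecahedron_matrices. equivalent_matrices A B)"
  unfolding dodecahedron_eq
proof (rule perfect_coloring_matrices_iff_listed)
  show "indexed_graph (edge_graph (convex hull (golden_vec ` set dodecahedron_vertices)))
      (\<lambda>i. golden_vec (dodecahedron_vertices ! i)) (adjacency dodecahedron_vertices (-1, 2))"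
    by (rule indexed_graph_golden_vec[OF solid_check_dodecahedron])
      (use golden_ratio_bounds in \<open>auto simp: golden_val_def\<close>)
qed (rule search_check_dodecahedron realizes_dodecahedron | simp add: dodecahedron_matrices_def)+

definition icosahedron_vertices :: "golden_point list" where
  "icosahedron_vertices =
    [((0, 0), (1, 0), (0, 1)), ((1, 0), (0, 1), (0, 0)), ((0, 1), (0, 0), (1, 0)),
     ((0, -1), (0, 0), (1, 0)), ((0, 0), (-1, 0), (0, 1)), ((-1, 0), (0, 1), (0, 0)),
     ((0, 0), (1, 0), (0, -1)), ((0, 1), (0, 0), (-1, 0)), ((1, 0), (0, -1), (0, 0)),
     ((-1, 0), (0, -1), (0, 0)), ((0, -1), (0, 0), (-1, 0)), ((0, 0), (-1, 0), (0, -1))]"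

definition icosahedron_matrices :: "nat list list list" where
  "icosahedron_matrices =
    [[[0, 0, 0, 5], [0, 0, 5, 0], [0, 1, 2, 2], [1, 0, 2, 2]],
     [[0, 1, 1, 3], [1, 0, 1, 3], [1, 1, 0, 3], [1, 1, 1, 2]],
     [[0, 1, 2, 2], [1, 0, 2, 2], [1, 1, 1, 2], [1, 1, 2, 1]],
     [[0, 1, 2, 2], [1, 2, 0, 2], [2, 0, 2, 1], [2, 2, 1, 0]]]"

lemma icosahedron_eq: "icosahedron = convex hull (golden_vec ` set icosahedron_vertices)"
  unfolding icosahedron_def
  by (rule arg_cong[where f = "\<lambda>V. convex hull V"],
      simp add: icosahedron_vertices_def golden_vec_def golden_val_def) blast

lemma solid_check_icosahedron:
  "solid_check icosahedron_vertices (2, 1) (0, 1) [(0, -1), (-2, -1)]"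
  by code_simp

lemma realizes_icosahedron:
  "list_all2 (realizes 4 (adjacency icosahedron_vertices (0, 1))) icosahedron_matrices
    [[2, 2, 3, 2, 3, 1, 2, 3, 0, 3, 2, 3],
     [3, 3, 3, 0, 1, 2, 1, 0, 2, 3, 3, 3],
     [2, 2, 3, 3, 0, 1, 0, 3, 1, 2, 3, 2],
     [1, 1, 1, 0, 3, 3, 0, 3, 0, 2, 2, 2]]"
  by code_simp

lemma search_check_icosahedron:
  "search_check 4 5 (adjacency icosahedron_vertices (0, 1)) icosahedron_matrices"
  by code_simp

lemma icosahedron_matrices_iff:
  "A \<in> perfect_coloring_matrices (edge_graph icosahedron) \<longleftrightarrow>
    (\<exists>B\<in>matrix4 ` set icosahedron_matrices. equivalent_matrices A B)"
  unfolding icosahedron_eq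
proof (rule perfect_coloring_matrices_iff_listed)
  show "indexed_graph (edge_graph (convex hull (golden_vec ` set icosahedron_vertices)))
      (\<lambda>i. golden_vec (icosahedron_vertices ! i)) (adjacency icosahedron_vertices (0, 1))"
    by (rule indexed_graph_golden_vec[OF solid_check_icosahedron])
      (use golden_ratio_bounds in \<open>auto simp: golden_val_def\<close>)
qed (rule search_check_icosahedron realizes_icosahedron | simp add: icosahedron_matrices_def)+

section \<open>The classification\<close>

theorem mainTheorem7:
  fixes A :: "real^4^4"
  shows "(A \<in> perfect_coloring_matrices (edge_graph tetrahedron) \<longleftrightarrow>
            (\<exists>B \<in> {vector [vector [0, 1, 1, 1], vector [1, 0, 1, 1], vector [1, 1, 0, 1], vector [1, 1, 1, 0]]}.
               equivalent_matrices A B)) \<and>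
         (A \<in> perfect_coloring_matrices (edge_graph cube) \<longleftrightarrow>
            (\<exists>B \<in> {vector [vector [0, 0, 0, 3], vector [0, 0, 3, 0], vector [0, 1, 0, 2], vector [1, 0, 2, 0]],
                   vector [vector [0, 0, 1, 2], vector [0, 0, 2, 1], vector [1, 2, 0, 0], vector [2, 1, 0, 0]],
                   vector [vector [0, 1, 1, 1], vector [1, 0, 1, 1], vector [1, 1, 0, 1], vector [1, 1, 1, 0]],
                   vector [vector [0, 1, 1, 1], vector [1, 0, 1, 1], vector [1, 1, 1, 0], vector [1, 1, 0, 1]],
                   vector [vector [1, 0, 1, 1], vector [0, 1, 1, 1], vector [1, 1, 1, 0], vector [1, 1, 0, 1]]}.
               equivalent_matrices A B)) \<and>
         (A \<in> perfect_coloring_matrices (edge_graph octahedron) \<longleftrightarrow>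
            (\<exists>B \<in> {vector [vector [0, 0, 2, 2], vector [0, 0, 2, 2], vector [1, 1, 0, 2], vector [1, 1, 2, 0]],
                   vector [vector [0, 0, 2, 2], vector [0, 0, 2, 2], vector [1, 1, 1, 1], vector [1, 1, 1, 1]]}.
               equivalent_matrices A B)) \<and>
         (A \<in> perfect_coloring_matrices (edge_graph dodecahedron) \<longleftrightarrow>
            (\<exists>B \<in> {vector [vector [0, 0, 0, 3], vector [0, 0, 2, 1], vector [0, 2, 0, 1], vector [1, 1, 1, 0]],
                   vector [vector [0, 0, 0, 3], vector [0, 1, 1, 1], vector [0, 1, 1, 1], vector [1, 1, 1, 0]],
                   vector [vector [0, 0, 1, 2], vector [0, 0, 1, 2], vector [1, 1, 1, 0], vector [1, 1, 0, 1]],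
                   vector [vector [0, 0, 1, 2], vector [0, 2, 0, 1], vector [1, 0, 2, 0], vector [2, 1, 0, 0]],
                   vector [vector [1, 0, 0, 2], vector [0, 1, 0, 2], vector [0, 0, 1, 2], vector [1, 1, 1, 0]]}.
               equivalent_matrices A B)) \<and>
         (A \<in> perfect_coloring_matrices (edge_graph icosahedron) \<longleftrightarrow>
            (\<exists>B \<in> {vector [vector [0, 0, 0, 5], vector [0, 0, 5, 0], vector [0, 1, 2, 2], vector [1, 0, 2, 2]],
                   vector [vector [0, 1, 1, 3], vector [1, 0, 1, 3], vector [1, 1, 0, 3], vector [1, 1, 1, 2]],
                   vector [vector [0, 1, 2, 2], vector [1, 0, 2, 2], vector [1, 1, 1, 2], vector [1, 1, 2, 1]],
                   vector [vector [0, 1, 2, 2], vector [1, 2, 0, 2], vector [2, 0, 2, 1], vector [2, 2, 1, 0]]}.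
               equivalent_matrices A B))"
  using tetrahedron_matrices_iff[of A] cube_matrices_iff[of A] octahedron_matrices_iff[of A]
    dodecahedron_matrices_iff[of A] icosahedron_matrices_iff[of A]
  by (simp add: matrix4_def tetrahedron_matrices_def cube_matrices_def octahedron_matrices_def
      dodecahedron_matrices_def icosahedron_matrices_def)

end
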